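(* Consider the hybrid AC/DC network dynamics described in the context, in closed loop with the secondary control scheme $$T_\xi\dot\xi=-\mathcal L\xi-\tilde Q\hat\omega,\qquad p^G=\tilde Q\xi,$$ together with, for every interlinking converter connecting an AC bus $i$ to a DC subsystem $k$, the converter control $\omega_i=m\bar V_k$, where $m>0$ is a constant. Then every equilibrium of this closed-loop system solves the optimal power sharing problem; i.e. its generation vector $p^{G\ast}$ is a solution of $$\min_{p^G}\ \tfrac12 (p^G)^TQp^G\quad\text{subject to}\quad \mathbf 1^Tp^G=\mathbf 1^Tp^L+\sum_{j\in N_{ac}\setminus X_{ac}}D_j\omega_j,\qquad p^G_j=0\ \ (j\in X_{ac}),$$ where the $\omega_j$ in the constraint are the equilibrium frequency deviations.
   Context: Network. $N=\{1,\dots,|N|\}$ is a finite set of buses and $E$ a finite set of transmission lines, each given an arbitrary direction. The buses are partitioned as $N=N_{ac}\cup N_{dc}$ into AC and DC buses, where $N_{ac}$ is the disjoint union of the bus sets $N_i^{ac}$ of the AC subsystems and $N_{dc}$ the disjoint union of the bus sets $N_k^{dc}$ of the DC subsystems. Each subsystem, with its lines, is a connected graph. $E=E_{ac}\cup E_{dc}$, where $E_{ac}$ (resp. $E_{dc}$) are the lines inside AC (resp. DC) subsystems; there are no lines between different subsystems. Different subsystems are connected only through interlinking converters (ILCs), forming the set $X$; ILC $x\in X$ connects an AC bus $X_x^{ac}\in N_{ac}$ to a DC bus $X_x^{dc}\in N_{dc}$. The overall network (lines together with ILCs) is connected, and each bus hosts at most one ILC. Let $X_{ac}=\{X_x^{ac}:x\in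 X\}$ and $X_{dc}=\{X_x^{dc}:x\in X\}$. Variables and constants. $\omega_j$ ($j\in N_{ac}$) is the AC frequency deviation from nominal, $\eta_{ij}$ ($(i,j)\in E_{ac}$) the voltage angle difference between buses $i$ and $j$, $V_j$ ($j\in N_{dc}$) the DC voltage deviation from nominal, $p^G_j$ the generated power, $p^L_j$ the (constant) load, $p_{ij}$ the power transfer on line $(i,j)$, and $p^X_j$ the power leaving bus $j$ through the ILC. One has $p^X_j=0$ for $j\notin X_{ac}\cup X_{dc}$, and $p^X_{X_x^{dc}}=-p^X_{X_x^{ac}}$ for every $x\in X$ (instantaneous lossless converters). Also $p^G_j=0$ for $j\in X_{ac}$. Inertias $M_j>0$ and damping coefficients $D_j>0$ ($j\in N_{ac}\setminus X_{ac}$), capacitances $C_j>0$ ($j\in N_{dc}$), AC line susceptances $B_{ij}>0$ and DC line conductances $G_{ij}>0$ are constants. Dynamics. $$\dot\eta_{ij}=\omega_i-\omega_j,\quad (i,j)\in E_{ac},$$ $$M_j\dot\omega_j=p^G_j-p^L_j+\sum_{i:i\to j}p_{ij}-\sum_{k:j\to k}p_{jk}-D_j\omega_j,\quad j\in N_{ac}\setminus X_{ac},$$ $$0=p^G_j-p^L_j+\sum_{i:i\to j}p_{ij}-\sum_{k:j\to k}p_{jk}-p^X_j,\quad j\in X_{ac},$$ $$C_j\dot V_j=p^G_j-p^L_j+\sum_{i:i\to j}p_{ij}-\sum_{k:j\to k}p_{jk}-p^X_j,\quad j\in N_{dc},$$ with $p_{ij}=B_{ij}\sin\eta_{ij}$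 for $(i,j)\in E_{ac}$ and $p_{ij}=G_{ij}(V_i-V_j)$ for $(i,j)\in E_{dc}$. Here $i:i\to j$ and $k:j\to k$ range over predecessors and successors of $j$ in the directed graph $(N,E)$. Vectors. $\eta=[\eta_{ij}]_{(i,j)\in E_{ac}}$, $\omega=[\omega_j]_{j\in N_{ac}}$, $\omega^G=[\omega_j]_{j\in N_{ac}\setminus X_{ac}}$, $V=[V_j]_{j\in N_{dc}}$, $p^G=[p^G_j]_{j\in N}$, $p^L=[p^L_j]_{j\in N}$ (AC buses first, then DC buses). $\mathbf 1$ is the all-ones vector. Control data. $Q$ is a positive definite diagonal matrix of cost coefficients indexed by $N$; $\tilde Q$ is the diagonal matrix with $\tilde Q_{ii}=Q_{ii}^{-1}$ for $i\in N\setminus X_{ac}$ and $\tilde Q_{ii}=0$ for $i\in X_{ac}$. For each DC subsystem $k$, the capacitance-weighted average voltage deviation is $\bar V_k=\sum_{j\in N_k^{dc}}C_jV_j$. The virtual frequency deviation $\hat\omega=[\hat\omega_j]_{j\in N}$ is $\hat\omega_j=\omega_j$ if $j\in N_{ac}$ and $\hat\omega_j=m\bar V_k$ if $j\in N_k^{dc}$. $\xi=[\xi_j]_{j\in N}$ is a vector of communicated synchronizing variables, $T_\xi$ is a diagonal matrix of positive time constants, and $\mathcal L$ is the graph Laplacian of an undirected connected communication graph $(N,\tilde E)$ (i.e. $\mathcal L_{ii}=\deg(i)$, $\mathcal L_{ij}=-1$ if $(i,j)\in\tilde E$, and $0$ otherwise). Equilibrium. An equilibrium is a constant state $(\eta^\ast,\omega^{G\ast},V^\ast,\xi^\ast)$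 (with corresponding constant values of the remaining variables) at which $$0=\omega_i-\omega_j,\quad (i,j)\in E_{ac},$$ $$0=p^G_j-p^L_j+\sum_{i:i\to j}p_{ij}-\sum_{k:j\to k}p_{jk}-D_j\omega_j,\quad j\in N_{ac}\setminus X_{ac},$$ $$0=p^G_j-p^L_j+\sum_{i:i\to j}p_{ij}-\sum_{k:j\to k}p_{jk}-p^X_j,\quad j\in X_{ac}\cup N_{dc},$$ $$0=-\mathcal L\xi-\tilde Q\hat\omega,$$ with $p_{ij}=B_{ij}\sin\eta_{ij}$ for $(i,j)\in E_{ac}$, $p_{ij}=G_{ij}(V_i-V_j)$ for $(i,j)\in E_{dc}$, $p^X_j=0$ for $j\notin X_{ac}\cup X_{dc}$, $p^X_{X_x^{dc}}=-p^X_{X_x^{ac}}$ for every $x\in X$, and with the control laws $p^G=\tilde Q\xi$ and $\omega_i=m\bar V_k$ for every ILC connecting an AC bus $i$ to a DC subsystem $k$; in particular the frequencies of all AC buses in a common AC subsystem coincide. *)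

theory Defs
  imports "HOL-Analysis.Analysis" "Graph_Theory.Graph_Theory"
begin

text \<open>
  Buses are the elements of a finite type \<open>'n\<close>. A subsystem is represented by its set of
  buses. A line is the ordered pair of its endpoints in the chosen direction. Since each bus hosts
  at most one converter, a converter is represented by the pair (AC bus, DC bus) it connects.
  Functions on buses or lines are only used where the corresponding quantity exists: inertias and
  dampings on AC buses without converter, capacitances and voltages on DC buses, frequencies on AC
  buses, susceptances and angle differences on AC lines, conductances on DC lines.
\<close>

record 'n hybrid_network =
  ac_subsystems :: "'n set set"
  dc_subsystems :: "'n set set"
  lines :: "('n \<times> 'n) set"
  converters :: "('n \<times> 'n) set"
  inertia :: "'n \<Rightarrow> real"
  damping :: "'n \<Rightarrow> real"
  capacitance :: "'n \<Rightarrow> real"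
  susceptance :: "'n \<times> 'n \<Rightarrow> real"
  conductance :: "'n \<times> 'n \<Rightarrow> real"
  load_power :: "'n \<Rightarrow> real"

definition ac_buses :: "'n hybrid_network \<Rightarrow> 'n set" where
  "ac_buses net = \<Union> (ac_subsystems net)"

definition dc_buses :: "'n hybrid_network \<Rightarrow> 'n set" where
  "dc_buses net = \<Union> (dc_subsystems net)"

definition converter_ac_buses :: "'n hybrid_network \<Rightarrow> 'n set" where
  "converter_ac_buses net = fst ` converters net"

definition converter_dc_buses :: "'n hybrid_network \<Rightarrow> 'n set" where
  "converter_dc_buses net = snd ` converters net"

definition ac_lines :: "'n hybrid_network \<Rightarrow> ('n \<times> 'n) set" where
  "ac_lines net = lines net \<inter> (\<Union>S \<in> ac_subsystems net. S \<times> S)"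

definition dc_lines :: "'n hybrid_network \<Rightarrow> ('n \<times> 'n) set" where
  "dc_lines net = lines net \<inter> (\<Union>S \<in> dc_subsystems net. S \<times> S)"

text \<open>The constant \<open>Digraph_Component.connected\<close> disregards the direction of arcs.\<close>

definition subsystem_graph :: "'n hybrid_network \<Rightarrow> 'n set \<Rightarrow> 'n pair_pre_digraph" where
  "subsystem_graph net S = \<lparr> pverts = S, parcs = lines net \<inter> S \<times> S \<rparr>"

definition network_graph :: "'n hybrid_network \<Rightarrow> 'n pair_pre_digraph" where
  "network_graph net = \<lparr> pverts = UNIV, parcs = lines net \<union> converters net \<rparr>"

definition valid_network :: "'n::finite hybrid_network \<Rightarrow> bool" where
  "valid_network net \<longleftrightarrow>
     partition_on UNIV (ac_subsystems net \<union> dc_subsystems net) \<and>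
     ac_subsystems net \<inter> dc_subsystems net = {} \<and>
     lines net = ac_lines net \<union> dc_lines net \<and>
     (\<forall>S \<in> ac_subsystems net \<union> dc_subsystems net.
        Digraph_Component.connected (with_proj (subsystem_graph net S))) \<and>
     converters net \<subseteq> ac_buses net \<times> dc_buses net \<and>
     inj_on fst (converters net) \<and> inj_on snd (converters net) \<and>
     Digraph_Component.connected (with_proj (network_graph net)) \<and>
     (\<forall>j \<in> ac_buses net - converter_ac_buses net. inertia net j > 0 \<and> damping net j > 0) \<and>
     (\<forall>j \<in> dc_buses net. capacitance net j > 0) \<and>
     (\<forall>e \<in> ac_lines net. susceptance net e > 0) \<and>
     (\<forall>e \<in> dc_lines net. conductance net e > 0)"

definition line_power ::
    "'n hybrid_network \<Rightarrow> ('n \<times> 'n \<Rightarrow> real) \<Rightarrow> ('n \<Rightarrow> real) \<Rightarrow> 'n \<times> 'n \<Rightarrow> real" where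
  "line_power net \<eta> V e =
     (if e \<in> ac_lines net then susceptance net e * sin (\<eta> e)
      else conductance net e * (V (fst e) - V (snd e)))"

definition net_power ::
    "'n::finite hybrid_network \<Rightarrow> ('n \<times> 'n \<Rightarrow> real) \<Rightarrow> ('n \<Rightarrow> real) \<Rightarrow> real^'n \<Rightarrow> 'n \<Rightarrow> real" where
  "net_power net \<eta> V pG j =
     pG $ j - load_power net j
     + (\<Sum>i | (i, j) \<in> lines net. line_power net \<eta> V (i, j))
     - (\<Sum>k | (j, k) \<in> lines net. line_power net \<eta> V (j, k))"

definition diagonal_matrix :: "real^'n^'n \<Rightarrow> bool" where
  "diagonal_matrix A \<longleftrightarrow> (\<forall>i j. i \<noteq> j \<longrightarrow> A $ i $ j = 0)"

definition positive_definite :: "real^'n^'n \<Rightarrow> bool" where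
  "positive_definite A \<longleftrightarrow> transpose A = A \<and> (\<forall>x. x \<noteq> 0 \<longrightarrow> x \<bullet> (A *v x) > 0)"

definition graph_laplacian :: "'n::finite pair_pre_digraph \<Rightarrow> real^'n^'n" where
  "graph_laplacian G =
     (\<chi> i j. if i = j then real (out_degree (with_proj G) i)
            else if (i, j) \<in> parcs G then -1 else 0)"

record 'n control_data =
  cost_matrix :: "real^'n^'n"
  time_constants :: "real^'n^'n"
  comm_graph :: "'n pair_pre_digraph"
  gain :: real

text \<open>
  An undirected graph is a \<open>pair_graph\<close>: a finite loop-free digraph with symmetric arc set.
\<close>

definition valid_control :: "'n::finite control_data \<Rightarrow> bool" where
  "valid_control ctrl \<longleftrightarrow>
     diagonal_matrix (cost_matrix ctrl) \<and> positive_definite (cost_matrix ctrl) \<and>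
     diagonal_matrix (time_constants ctrl) \<and> (\<forall>j. time_constants ctrl $ j $ j > 0) \<and>
     pair_graph (comm_graph ctrl) \<and> pverts (comm_graph ctrl) = UNIV \<and>
     Digraph_Component.connected (with_proj (comm_graph ctrl)) \<and>
     gain ctrl > 0"

definition inverse_cost_matrix ::
    "'n::finite hybrid_network \<Rightarrow> 'n control_data \<Rightarrow> real^'n^'n" where
  "inverse_cost_matrix net ctrl =
     (\<chi> i j. if i = j \<and> i \<notin> converter_ac_buses net then inverse (cost_matrix ctrl $ i $ i) else 0)"

text \<open>The capacitance-weighted average is not normalised by the total capacitance.\<close>

definition average_voltage ::
    "'n hybrid_network \<Rightarrow> ('n \<Rightarrow> real) \<Rightarrow> 'n set \<Rightarrow> real" where
  "average_voltage net V S = (\<Sum>j\<in>S. capacitance net j * V j)"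

definition dc_subsystem_of :: "'n hybrid_network \<Rightarrow> 'n \<Rightarrow> 'n set" where
  "dc_subsystem_of net j = (THE S. S \<in> dc_subsystems net \<and> j \<in> S)"

definition virtual_frequency ::
    "'n::finite hybrid_network \<Rightarrow> 'n control_data \<Rightarrow> ('n \<Rightarrow> real) \<Rightarrow> ('n \<Rightarrow> real) \<Rightarrow> real^'n" where
  "virtual_frequency net ctrl \<omega> V =
     (\<chi> j. if j \<in> ac_buses net then \<omega> j
          else gain ctrl * average_voltage net V (dc_subsystem_of net j))"

definition algebraic_relations ::
    "'n::finite hybrid_network \<Rightarrow> 'n control_data \<Rightarrow> ('n \<Rightarrow> real) \<Rightarrow> ('n \<Rightarrow> real) \<Rightarrow>
     real^'n \<Rightarrow> real^'n \<Rightarrow> ('n \<Rightarrow> real) \<Rightarrow> bool" where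
  "algebraic_relations net ctrl \<omega> V \<xi> pG pX \<longleftrightarrow>
     (\<forall>j. j \<notin> converter_ac_buses net \<union> converter_dc_buses net \<longrightarrow> pX j = 0) \<and>
     (\<forall>(i, j) \<in> converters net. pX j = - pX i) \<and>
     pG = inverse_cost_matrix net ctrl *v \<xi> \<and>
     (\<forall>(i, j) \<in> converters net.
        \<omega> i = gain ctrl * average_voltage net V (dc_subsystem_of net j))"

definition closed_loop_trajectory ::
    "'n::finite hybrid_network \<Rightarrow> 'n control_data \<Rightarrow> (real \<Rightarrow> 'n \<times> 'n \<Rightarrow> real) \<Rightarrow>
     (real \<Rightarrow> 'n \<Rightarrow> real) \<Rightarrow> (real \<Rightarrow> 'n \<Rightarrow> real) \<Rightarrow> (real \<Rightarrow> real^'n) \<Rightarrow>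
     (real \<Rightarrow> real^'n) \<Rightarrow> (real \<Rightarrow> 'n \<Rightarrow> real) \<Rightarrow> bool" where
  "closed_loop_trajectory net ctrl \<eta> \<omega> V \<xi> pG pX \<longleftrightarrow> (\<forall>t \<ge> 0.
     (\<forall>(i, j) \<in> ac_lines net.
        ((\<lambda>s. \<eta> s (i, j)) has_real_derivative \<omega> t i - \<omega> t j) (at t within {0..})) \<and>
     (\<forall>j \<in> ac_buses net - converter_ac_buses net.
        ((\<lambda>s. inertia net j * \<omega> s j) has_real_derivative
          net_power net (\<eta> t) (V t) (pG t) j - damping net j * \<omega> t j) (at t within {0..})) \<and>
     (\<forall>j \<in> converter_ac_buses net. 0 = net_power net (\<eta> t) (V t) (pG t) j - pX t j) \<and>
     (\<forall>j \<in> dc_buses net.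
        ((\<lambda>s. capacitance net j * V s j) has_real_derivative
          net_power net (\<eta> t) (V t) (pG t) j - pX t j) (at t within {0..})) \<and>
     ((\<lambda>s. time_constants ctrl *v \<xi> s) has_vector_derivative
        - (graph_laplacian (comm_graph ctrl) *v \<xi> t)
        - inverse_cost_matrix net ctrl *v virtual_frequency net ctrl (\<omega> t) (V t))
       (at t within {0..}) \<and>
     algebraic_relations net ctrl (\<omega> t) (V t) (\<xi> t) (pG t) (pX t))"

definition equilibrium ::
    "'n::finite hybrid_network \<Rightarrow> 'n control_data \<Rightarrow> ('n \<times> 'n \<Rightarrow> real) \<Rightarrow> ('n \<Rightarrow> real) \<Rightarrow>
     ('n \<Rightarrow> real) \<Rightarrow> real^'n \<Rightarrow> real^'n \<Rightarrow> ('n \<Rightarrow> real) \<Rightarrow> bool" where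
  "equilibrium net ctrl \<eta> \<omega> V \<xi> pG pX \<longleftrightarrow>
     (\<forall>(i, j) \<in> ac_lines net. 0 = \<omega> i - \<omega> j) \<and>
     (\<forall>j \<in> ac_buses net - converter_ac_buses net.
        0 = net_power net \<eta> V pG j - damping net j * \<omega> j) \<and>
     (\<forall>j \<in> converter_ac_buses net \<union> dc_buses net. 0 = net_power net \<eta> V pG j - pX j) \<and>
     0 = - (graph_laplacian (comm_graph ctrl) *v \<xi>)
         - inverse_cost_matrix net ctrl *v virtual_frequency net ctrl \<omega> V \<and>
     algebraic_relations net ctrl \<omega> V \<xi> pG pX"

lemma equilibrium_iff_constant_trajectory:
  "equilibrium net ctrl \<eta> \<omega> V \<xi> pG pX \<longleftrightarrow>
   closed_loop_trajectory net ctrl (\<lambda>_. \<eta>) (\<lambda>_. \<omega>) (\<lambda>_. V) (\<lambda>_. \<xi>) (\<lambda>_. pG) (\<lambda>_. pX)"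
proof
  assume "equilibrium net ctrl \<eta> \<omega> V \<xi> pG pX"
  then show "closed_loop_trajectory net ctrl (\<lambda>_. \<eta>) (\<lambda>_. \<omega>) (\<lambda>_. V) (\<lambda>_. \<xi>) (\<lambda>_. pG) (\<lambda>_. pX)"
    unfolding equilibrium_def closed_loop_trajectory_def by fastforce
next
  have at1: "at (1::real) within {0..} = at 1"
    by (rule at_within_interior) (simp add: interior_real_atLeast)
  have r: "((\<lambda>_. c) has_real_derivative d) (at 1) \<longleftrightarrow> d = 0" for c d :: real
    using DERIV_const DERIV_unique by blast
  have v: "((\<lambda>_. c) has_vector_derivative d) (at 1) \<longleftrightarrow> d = 0" for c d :: "real^'a"
    using has_vector_derivative_const vector_derivative_unique_at by blast
  assume "closed_loop_trajectory net ctrl (\<lambda>_. \<eta>) (\<lambda>_. \<omega>) (\<lambda>_. V) (\<lambda>_. \<xi>) (\<lambda>_. pG) (\<lambda>_. pX)"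
  note this[unfolded closed_loop_trajectory_def, rule_format, of 1, unfolded at1 r v]
  then show "equilibrium net ctrl \<eta> \<omega> V \<xi> pG pX"
    unfolding equilibrium_def by fastforce
qed

text \<open>In \<open>power_sharing_feasible\<close>, the vector \<open>1\<close> is the all-ones vector.\<close>

definition power_sharing_feasible ::
    "'n::finite hybrid_network \<Rightarrow> ('n \<Rightarrow> real) \<Rightarrow> real^'n \<Rightarrow> bool" where
  "power_sharing_feasible net \<omega> p \<longleftrightarrow>
     1 \<bullet> p = 1 \<bullet> (\<chi> j. load_power net j)
       + (\<Sum>j \<in> ac_buses net - converter_ac_buses net. damping net j * \<omega> j) \<and>
     (\<forall>j \<in> converter_ac_buses net. p $ j = 0)"

definition solves_optimal_power_sharing ::
    "'n::finite hybrid_network \<Rightarrow> 'n control_data \<Rightarrow> ('n \<Rightarrow> real) \<Rightarrow> real^'n \<Rightarrow> bool" where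
  "solves_optimal_power_sharing net ctrl \<omega> p \<longleftrightarrow>
     is_arg_min (\<lambda>q. 1 / 2 * (q \<bullet> (cost_matrix ctrl *v q))) (power_sharing_feasible net \<omega>) p"

end

theory Submission
  imports Defs
begin

text \<open>
  At an equilibrium the virtual frequency deviation is constant along lines and converters, hence
  equal to some \<open>c\<close> on the whole network. The entries of \<open>\<L> \<xi>\<close> sum to zero, so the synchronizing
  dynamics force \<open>c = 0\<close>; then \<open>\<L> \<xi> = 0\<close> and \<open>\<xi>\<close> is constant. Hence all generating buses have the
  same marginal cost, which is sufficient for optimality by convexity. Feasibility is the power
  balance summed over all buses, in which line flows and converter transfers cancel.
\<close>

section \<open>Connectedness and sums over arcs\<close>

lemma connected_eq_if_arcs_eq:
  assumes conn: "Digraph_Component.connected (with_proj G)"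
    and arcs: "\<And>i j. (i, j) \<in> parcs G \<Longrightarrow> f i = f j"
    and "u \<in> pverts G" "v \<in> pverts G"
  shows "f u = f v"
proof -
  \<comment> \<open>\<open>connected\<close> is strong connectedness of the symmetric closure, so
    each step of the walk is an arc of \<open>G\<close> in one direction or the other;
    \<open>f\<close> agrees across it either way.\<close>
  have "u \<rightarrow>\<^sup>*\<^bsub>mk_symmetric (with_proj G)\<^esub> v"
    using assms by (auto simp: connected_def strongly_connected_def)
  then show ?thesis
    unfolding reachable_def
    by (induction rule: rtrancl_on.induct)
      (auto simp: parcs_mk_symmetric arcs_ends_def arc_to_ends_def dest: arcs)
qed

lemma sum_successors:
  fixes f :: "'n::finite \<times> 'n \<Rightarrow> 'b::comm_monoid_add"
  shows "(\<Sum>j\<in>UNIV. \<Sum>k | (j, k) \<in> R. f (j, k)) = sum f R"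
proof -
  have "(\<Sum>j\<in>UNIV. \<Sum>k | (j, k) \<in> R. f (j, k)) = sum f (SIGMA j:UNIV. {k. (j, k) \<in> R})"
    by (simp add: sum.Sigma)
  also have "(SIGMA j:UNIV. {k. (j, k) \<in> R}) = R" by auto
  finally show ?thesis .
qed

lemma sum_predecessors:
  fixes f :: "'n::finite \<times> 'n \<Rightarrow> 'b::comm_monoid_add"
  shows "(\<Sum>j\<in>UNIV. \<Sum>i | (i, j) \<in> R. f (i, j)) = sum f R"
proof -
  have "(\<Sum>j\<in>UNIV. \<Sum>i | (i, j) \<in> R. f (i, j)) = (\<Sum>e\<in>R\<inverse>. f (prod.swap e))"
    using sum_successors[where R = "R\<inverse>" and f = "\<lambda>e. f (prod.swap e)"] by simp
  also have "\<dots> = sum f R"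
    by (rule sum.reindex_bij_witness[where i = prod.swap and j = prod.swap]) auto
  finally show ?thesis .
qed

section \<open>The graph Laplacian of an undirected graph\<close>

context
  fixes G :: "'n::finite pair_pre_digraph"
  assumes graph: "pair_graph G"
begin

text \<open>The diagonal entry is the number of neighbours, so it supplies one copy of
  \<open>x $ i\<close> for each subtracted \<open>x $ j\<close>.\<close>

lemma laplacian_mult_nth:
  "(graph_laplacian G *v x) $ i = (\<Sum>j | (i, j) \<in> parcs G. x $ i - x $ j)"
proof -
  interpret pair_graph G by (rule graph)
  \<comment> \<open>\<open>graph_laplacian\<close> tests \<open>i = j\<close> first, so a loop would
    get no entry \<open>-1\<close>; its absence lets each row split into a degree term minus an
    adjacency term.\<close>
  have noloop: "(i, i) \<notin> parcs G" using no_loops[of "(i, i)"] by auto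
  have "out_arcs (with_proj G) i = Pair i ` {j. (i, j) \<in> parcs G}"
    by (auto simp: out_arcs_def)
  then have deg: "out_degree (with_proj G) i = card {j. (i, j) \<in> parcs G}"
    by (simp add: out_degree_def card_image inj_on_def)
  have "(graph_laplacian G *v x) $ i =
      (\<Sum>j\<in>UNIV. (if j = i then real (card {j. (i, j) \<in> parcs G}) * x $ i else 0)
        - (if (i, j) \<in> parcs G then x $ j else 0))"
    unfolding matrix_vector_mult_def graph_laplacian_def
    by (auto simp: deg noloop intro!: sum.cong)
  also have "\<dots> = real (card {j. (i, j) \<in> parcs G}) * x $ i - (\<Sum>j | (i, j) \<in> parcs G. x $ j)"
    by (simp add: sum_subtractf sum.If_cases)
  finally show ?thesis by (simp add: sum_subtractf)
qed

lemma inner_laplacian: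
  "y \<bullet> (graph_laplacian G *v x) = (\<Sum>(i, j)\<in>parcs G. y $ i * (x $ i - x $ j))"
  using sum_successors[where R = "parcs G" and f = "\<lambda>(i, j). y $ i * (x $ i - x $ j)"]
  by (simp add: inner_vec_def laplacian_mult_nth sum_distrib_left)

lemma sum_arcs_swap:
  "(\<Sum>(i, j)\<in>parcs G. f i j) = (\<Sum>(i, j)\<in>parcs G. f j i)"
proof -
  interpret pair_graph G by (rule graph)
  show ?thesis
    by (rule sum.reindex_bij_witness[where i = prod.swap and j = prod.swap])
      (auto intro: arcs_symmetric)
qed

text \<open>Reversing all arcs turns the sum of \<open>x $ i\<close> into the sum of
  \<open>x $ j\<close>, so the two cancel.\<close>

lemma one_inner_laplacian: "1 \<bullet> (graph_laplacian G *v x) = 0"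
  using sum_arcs_swap[of "\<lambda>i j. x $ i"]
  by (simp add: inner_laplacian sum_subtractf case_prod_unfold)

text \<open>Each undirected edge occurs as two opposite arcs. Adding the form to its arc-reversed
  copy pairs the products into squares, hence the factor 2.\<close>

lemma inner_laplacian_self:
  "2 * (x \<bullet> (graph_laplacian G *v x)) = (\<Sum>(i, j)\<in>parcs G. (x $ i - x $ j)\<^sup>2)"
proof -
  have "2 * (x \<bullet> (graph_laplacian G *v x)) =
      (\<Sum>(i, j)\<in>parcs G. x $ i * (x $ i - x $ j)) + (\<Sum>(i, j)\<in>parcs G. x $ j * (x $ j - x $ i))"
    using sum_arcs_swap[of "\<lambda>i j. x $ i * (x $ i - x $ j)"] by (simp add: inner_laplacian)
  also have "\<dots> = (\<Sum>(i, j)\<in>parcs G. (x $ i - x $ j)\<^sup>2)"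
    unfolding sum.distrib[symmetric] case_prod_unfold
    by (intro sum.cong) (auto simp: power2_eq_square algebra_simps)
  finally show ?thesis .
qed

text \<open>The quadratic form vanishes at \<open>x\<close>, so every square in it does;
  \<open>x\<close> then agrees across each arc, and connectedness spreads this to all
  vertices.\<close>

lemma laplacian_kernel_constant:
  assumes "Digraph_Component.connected (with_proj G)"
    and "graph_laplacian G *v x = 0" "u \<in> pverts G" "v \<in> pverts G"
  shows "x $ u = x $ v"
proof (rule connected_eq_if_arcs_eq[OF assms(1)])
  fix i j assume "(i, j) \<in> parcs G"
  moreover have "(\<Sum>(i, j)\<in>parcs G. (x $ i - x $ j)\<^sup>2) = 0"
    using inner_laplacian_self[of x] assms(2) by simp
  then have "\<forall>e\<in>parcs G. (x $ fst e - x $ snd e)\<^sup>2 = 0"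
    by (subst (asm) sum_nonneg_eq_0_iff) (auto simp: case_prod_unfold)
  ultimately show "x $ i = x $ j" by force
qed fact+

end

section \<open>The cost matrix and its partial inverse\<close>

lemma inner_diagonal_matrix:
  assumes "diagonal_matrix A"
  shows "x \<bullet> (A *v y) = (\<Sum>i\<in>UNIV. A $ i $ i * x $ i * y $ i)"
proof -
  have "(A *v y) $ i = A $ i $ i * y $ i" for i
  proof -
    have "(\<Sum>j\<in>UNIV. A $ i $ j * y $ j) = (\<Sum>j\<in>UNIV. if j = i then A $ i $ i * y $ i else 0)"
      using assms by (intro sum.cong) (auto simp: diagonal_matrix_def)
    then show ?thesis by (simp add: matrix_vector_mult_def)
  qed
  then show ?thesis by (simp add: inner_vec_def mult.left_commute mult.commute)
qed

lemma positive_definite_diagonal_pos: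
  assumes "diagonal_matrix A" "positive_definite A"
  shows "A $ i $ i > 0"
proof -
  have "axis i 1 \<bullet> (A *v axis i 1) > 0"
    using assms(2) by (simp add: positive_definite_def axis_eq_0_iff)
  moreover have "axis i 1 \<bullet> (A *v axis i 1) = (\<Sum>j\<in>UNIV. if j = i then A $ i $ i else 0)"
    unfolding inner_diagonal_matrix[OF assms(1)] by (intro sum.cong) (auto simp: axis_def)
  ultimately show ?thesis by simp
qed

lemma inverse_cost_matrix_mult_nth:
  "(inverse_cost_matrix net ctrl *v x) $ i =
     (if i \<in> converter_ac_buses net then 0 else x $ i / cost_matrix ctrl $ i $ i)"
  by (cases "i \<in> converter_ac_buses net")
    (simp_all add: matrix_vector_mult_def inverse_cost_matrix_def divide_inverse
      if_distrib[where f = "\<lambda>c. c * _"] mult.commute[of "x $ i"] cong: if_cong)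

text \<open>Each line contributes its power once as inflow and once as outflow, so only generation
  and load survive.\<close>

lemma sum_net_power:
  "(\<Sum>j\<in>UNIV. net_power net \<eta> V pG j) = 1 \<bullet> pG - 1 \<bullet> (\<chi> j. load_power net j)"
  by (simp add: net_power_def sum.distrib sum_subtractf sum_successors sum_predecessors inner_vec_def)

section \<open>Buses, subsystems and converters\<close>

lemma ac_dc_buses_disjoint:
  assumes "valid_network net"
  shows "ac_buses net \<inter> dc_buses net = {}"
proof -
  have disj: "disjoint (ac_subsystems net \<union> dc_subsystems net)"
    and ne: "ac_subsystems net \<inter> dc_subsystems net = {}"
    using assms unfolding valid_network_def partition_on_def by blast+
  have "S \<inter> T = {}" if "S \<in> ac_subsystems net" "T \<in> dc_subsystems net" for S T
    using that ne by (intro disjointD[OF disj]) auto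
  then show ?thesis unfolding ac_buses_def dc_buses_def by blast
qed

lemma ac_dc_buses_UNIV:
  assumes "valid_network net"
  shows "ac_buses net \<union> dc_buses net = UNIV"
  using assms unfolding valid_network_def partition_on_def ac_buses_def dc_buses_def
  by (simp only: Union_Un_distrib)

lemma converter_buses_subset:
  assumes "valid_network net"
  shows "converter_ac_buses net \<subseteq> ac_buses net" "converter_dc_buses net \<subseteq> dc_buses net"
proof -
  have "converters net \<subseteq> ac_buses net \<times> dc_buses net"
    using assms unfolding valid_network_def by blast
  then show "converter_ac_buses net \<subseteq> ac_buses net" "converter_dc_buses net \<subseteq> dc_buses net"
    unfolding converter_ac_buses_def converter_dc_buses_def by auto
qed

lemma dc_subsystem_of_eq:
  assumes "valid_network net" "S \<in> dc_subsystems net" "j \<in> S"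
  shows "dc_subsystem_of net j = S"
  unfolding dc_subsystem_of_def
proof (rule the_equality)
  fix T assume T: "T \<in> dc_subsystems net \<and> j \<in> T"
  have "disjoint (ac_subsystems net \<union> dc_subsystems net)"
    using assms(1) unfolding valid_network_def partition_on_def by blast
  then have "T \<inter> S = {}" if "T \<noteq> S"
    by (rule disjointD) (use T assms(2) that in auto)
  then show "T = S" using T assms(3) by auto
qed (use assms in simp)

text \<open>Guarantees that the sum of inverse costs over generating buses is strictly positive. If
  there is a converter, its DC end is a witness; otherwise any bus is.\<close>

lemma exists_non_converter_ac_bus:
  assumes "valid_network net"
  shows "\<exists>j. j \<notin> converter_ac_buses net"
proof (cases "converter_ac_buses net = {}")
  case False
  then obtain i k where "(i, k) \<in> converters net" by (auto simp: converter_ac_buses_def)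
  then have "k \<in> converter_dc_buses net" by (force simp: converter_dc_buses_def)
  then have "k \<notin> converter_ac_buses net"
    using ac_dc_buses_disjoint[OF assms] converter_buses_subset[OF assms] by blast
  then show ?thesis ..
qed simp

lemma sum_converter_power:
  assumes net: "valid_network net"
    and zero: "\<forall>j. j \<notin> converter_ac_buses net \<union> converter_dc_buses net \<longrightarrow> pX j = 0"
    and lossless: "\<forall>(i, j) \<in> converters net. pX j = - pX i"
  shows "(\<Sum>j\<in>UNIV. pX j) = (0::real)"
proof -
  have inj: "inj_on fst (converters net)" "inj_on snd (converters net)"
    using net unfolding valid_network_def by blast+
  have "(\<Sum>j\<in>UNIV. pX j) = sum pX (converter_ac_buses net \<union> converter_dc_buses net)"
    using zero by (intro sum.mono_neutral_right) auto
  also have "\<dots> = sum pX (converter_ac_buses net) + sum pX (converter_dc_buses net)"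
    using ac_dc_buses_disjoint[OF net] converter_buses_subset[OF net]
    by (intro sum.union_disjoint) auto
  \<comment> \<open>As each bus hosts at most one converter, both bus sums reindex over converters,
    where the two ends cancel.\<close>
  also have "\<dots> = (\<Sum>e\<in>converters net. pX (fst e) + pX (snd e))"
    by (simp add: converter_ac_buses_def converter_dc_buses_def sum.reindex inj sum.distrib)
  also have "\<dots> = 0" using lossless by (intro sum.neutral) auto
  finally show ?thesis .
qed

section \<open>Consequences of the equilibrium equations\<close>

lemma equilibrium_virtual_frequency_constant:
  assumes net: "valid_network net" and eq: "equilibrium net ctrl \<eta> \<omega> V \<xi> pG pX"
  shows "virtual_frequency net ctrl \<omega> V $ u = virtual_frequency net ctrl \<omega> V $ v"
proof (rule connected_eq_if_arcs_eq[where f = "\<lambda>j. virtual_frequency net ctrl \<omega> V $ j"])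
  show "Digraph_Component.connected (with_proj (network_graph net))"
    using net unfolding valid_network_def by blast
next
  \<comment> \<open>Equality across an arc has three sources: the angle equation on AC lines, a
    shared average voltage on DC lines, and the control law at converters.\<close>
  fix i j assume "(i, j) \<in> parcs (network_graph net)"
  moreover have "lines net = ac_lines net \<union> dc_lines net"
    using net unfolding valid_network_def by blast
  ultimately consider "(i, j) \<in> ac_lines net" | "(i, j) \<in> dc_lines net" | "(i, j) \<in> converters net"
    by (auto simp: network_graph_def)
  then show "virtual_frequency net ctrl \<omega> V $ i = virtual_frequency net ctrl \<omega> V $ j"
  proof cases
    case 1
    then have "i \<in> ac_buses net" "j \<in> ac_buses net"
      by (auto simp: ac_lines_def ac_buses_def)
    moreover have "\<omega> i = \<omega> j" using 1 eq by (auto simp: equilibrium_def)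
    ultimately show ?thesis by (simp add: virtual_frequency_def)
  next
    case 2
    then obtain S where S: "S \<in> dc_subsystems net" "i \<in> S" "j \<in> S"
      by (auto simp: dc_lines_def)
    then have "i \<notin> ac_buses net" "j \<notin> ac_buses net"
      using ac_dc_buses_disjoint[OF net] by (auto simp: dc_buses_def)
    then show ?thesis
      using S by (simp add: virtual_frequency_def dc_subsystem_of_eq[OF net])
  next
    case 3
    then have "i \<in> converter_ac_buses net" "j \<in> converter_dc_buses net"
      by (force simp: converter_ac_buses_def converter_dc_buses_def)+
    then have "i \<in> ac_buses net" "j \<notin> ac_buses net"
      using converter_buses_subset[OF net] ac_dc_buses_disjoint[OF net] by auto
    moreover have "\<omega> i = gain ctrl * average_voltage net V (dc_subsystem_of net j)"
      using 3 eq by (auto simp: equilibrium_def algebraic_relations_def)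
    ultimately show ?thesis by (simp add: virtual_frequency_def)
  qed
qed (simp_all add: network_graph_def)

lemma equilibrium_synchronized:
  assumes net: "valid_network net" and ctrl: "valid_control ctrl"
    and eq: "equilibrium net ctrl \<eta> \<omega> V \<xi> pG pX"
  shows "\<xi> $ u = \<xi> $ v"
proof -
  let ?L = "graph_laplacian (comm_graph ctrl)" and ?Q = "cost_matrix ctrl"
  let ?w = "virtual_frequency net ctrl \<omega> V" and ?X = "converter_ac_buses net"
  have graph: "pair_graph (comm_graph ctrl)" "pverts (comm_graph ctrl) = UNIV"
    "Digraph_Component.connected (with_proj (comm_graph ctrl))"
    using ctrl by (auto simp: valid_control_def)
  have pos: "?Q $ j $ j > 0" for j
    using ctrl by (intro positive_definite_diagonal_pos) (auto simp: valid_control_def)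
  have dyn: "?L *v \<xi> = - (inverse_cost_matrix net ctrl *v ?w)"
    using eq by (simp add: equilibrium_def) (metis add.inverse_inverse eq_iff_diff_eq_0)
  obtain k where k: "k \<notin> ?X" using exists_non_converter_ac_bus[OF net] ..
  define c where "c = ?w $ k"
  have w: "?w $ j = c" for j
    unfolding c_def by (rule equilibrium_virtual_frequency_constant[OF net eq])
  \<comment> \<open>Pairing with the all-ones vector eliminates \<open>\<xi>\<close> and leaves one
    scalar equation for \<open>c\<close>.\<close>
  have "0 = 1 \<bullet> (inverse_cost_matrix net ctrl *v ?w)"
    using one_inner_laplacian[OF graph(1), of \<xi>] by (simp add: dyn)
  also have "\<dots> = (\<Sum>j\<in>UNIV. if j \<in> ?X then 0 else c / ?Q $ j $ j)"
    by (simp add: inner_vec_def inverse_cost_matrix_mult_nth w cong: if_cong)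
  also have "\<dots> = c * (\<Sum>j\<in>UNIV. if j \<in> ?X then 0 else 1 / ?Q $ j $ j)"
    by (auto simp: sum_distrib_left intro!: sum.cong)
  finally have "c * (\<Sum>j\<in>UNIV. if j \<in> ?X then 0 else 1 / ?Q $ j $ j) = 0" by simp
  moreover have "(\<Sum>j\<in>UNIV. if j \<in> ?X then 0 else 1 / ?Q $ j $ j) > 0"
    by (rule sum_pos2[where i = k]) (use k pos less_imp_le[OF pos] in auto)
  ultimately have "c = 0" by simp
  then have "?L *v \<xi> = 0"
    by (simp add: dyn vec_eq_iff inverse_cost_matrix_mult_nth w)
  then show ?thesis
    using laplacian_kernel_constant[OF graph(1,3)] graph(2) by blast
qed

lemma equilibrium_feasible:
  assumes net: "valid_network net" and eq: "equilibrium net ctrl \<eta> \<omega> V \<xi> pG pX"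
  shows "power_sharing_feasible net \<omega> pG"
proof -
  let ?X = "converter_ac_buses net"
  \<comment> \<open>One formula for all buses: \<open>pX\<close> vanishes at AC buses without
    converter, and damping enters only there.\<close>
  have balance: "net_power net \<eta> V pG j =
      (if j \<in> ac_buses net - ?X then damping net j * \<omega> j else 0) + pX j" for j
  proof (cases "j \<in> ac_buses net - ?X")
    case True
    then have "pX j = 0"
      using eq ac_dc_buses_disjoint[OF net] converter_buses_subset[OF net]
      by (auto simp: equilibrium_def algebraic_relations_def)
    then show ?thesis using True eq by (auto simp: equilibrium_def)
  next
    case False
    then have "j \<in> ?X \<union> dc_buses net" using ac_dc_buses_UNIV[OF net] by blast
    then show ?thesis using False eq by (auto simp: equilibrium_def)
  qed
  have "(\<Sum>j\<in>UNIV. pX j) = 0"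
    using eq by (intro sum_converter_power[OF net]) (auto simp: equilibrium_def algebraic_relations_def)
  then have "(\<Sum>j\<in>UNIV. net_power net \<eta> V pG j) = (\<Sum>j\<in>ac_buses net - ?X. damping net j * \<omega> j)"
    by (simp only: balance sum.distrib sum.If_cases[OF finite] Collect_mem_eq) simp
  moreover have "pG $ j = 0" if "j \<in> ?X" for j
    using eq that by (auto simp: equilibrium_def algebraic_relations_def inverse_cost_matrix_mult_nth)
  ultimately show ?thesis
    unfolding power_sharing_feasible_def sum_net_power by (auto simp: diff_eq_eq add.commute)
qed

section \<open>Optimality from equal marginal costs\<close>

lemma equal_marginal_cost_optimal:
  assumes ctrl: "valid_control ctrl" and feas: "power_sharing_feasible net \<omega> p"
    and marginal: "\<And>j. j \<notin> converter_ac_buses net \<Longrightarrow> cost_matrix ctrl $ j $ j * p $ j = a"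
  shows "solves_optimal_power_sharing net ctrl \<omega> p"
proof -
  let ?Q = "cost_matrix ctrl"
  have diag: "diagonal_matrix ?Q" "positive_definite ?Q"
    using ctrl by (auto simp: valid_control_def)
  have "p \<bullet> (?Q *v p) \<le> q \<bullet> (?Q *v q)" if q: "power_sharing_feasible net \<omega> q" for q
  proof -
    \<comment> \<open>\<open>2 * a\<close> is the derivative of the summand
      \<open>?Q $ j $ j * x\<^sup>2\<close> at \<open>x = p $ j\<close> for every generating bus.
      Feasible vectors have equal totals, so the first-order change from \<open>p\<close> to
      \<open>q\<close> is zero.\<close>
    have "0 = 2 * a * (1 \<bullet> q - 1 \<bullet> p)"
      using feas q by (simp add: power_sharing_feasible_def)
    also have "\<dots> = (\<Sum>j\<in>UNIV. 2 * a * (q $ j - p $ j))"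
      by (simp add: inner_vec_def flip: sum_subtractf sum_distrib_left)
    also have "\<dots> \<le> (\<Sum>j\<in>UNIV. ?Q $ j $ j * q $ j * q $ j - ?Q $ j $ j * p $ j * p $ j)"
    proof (rule sum_mono)
      fix j
      show "2 * a * (q $ j - p $ j) \<le> ?Q $ j $ j * q $ j * q $ j - ?Q $ j $ j * p $ j * p $ j"
      proof (cases "j \<in> converter_ac_buses net")
        case True
        \<comment> \<open>Here \<open>p $ j\<close> and \<open>q $ j\<close> are both zero, so no
          marginal condition is required at this bus.\<close>
        then show ?thesis using feas q by (simp add: power_sharing_feasible_def)
      next
        case False
        \<comment> \<open>This square is exactly the gap between the two sides once \<open>a\<close>
          is written as \<open>?Q $ j $ j * p $ j\<close>.\<close>
        have "0 \<le> ?Q $ j $ j * (q $ j - p $ j)\<^sup>2"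
          using positive_definite_diagonal_pos[OF diag, of j] by simp
        then show ?thesis
          unfolding marginal[OF False, symmetric] by (simp add: power2_eq_square algebra_simps)
      qed
    qed
    finally show ?thesis by (simp add: inner_diagonal_matrix[OF diag(1)] sum_subtractf)
  qed
  then show ?thesis
    using feas by (force simp: solves_optimal_power_sharing_def is_arg_min_linorder)
qed

theorem theorem3:
  fixes net :: "'n::finite hybrid_network"
    and ctrl :: "'n control_data"
    and \<eta> :: "'n \<times> 'n \<Rightarrow> real"
    and \<omega> V pX :: "'n \<Rightarrow> real"
    and \<xi> pG :: "real^'n"
  assumes "valid_network net"
    and "valid_control ctrl"
    and "equilibrium net ctrl \<eta> \<omega> V \<xi> pG pX"
  shows "solves_optimal_power_sharing net ctrl \<omega> pG"
proof (rule equal_marginal_cost_optimal)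
  show "power_sharing_feasible net \<omega> pG"
    using assms(1,3) by (rule equilibrium_feasible)
next
  fix j assume j: "j \<notin> converter_ac_buses net"
  have "cost_matrix ctrl $ j $ j > 0"
    using assms(2) by (intro positive_definite_diagonal_pos) (auto simp: valid_control_def)
  moreover have "pG = inverse_cost_matrix net ctrl *v \<xi>"
    using assms(3) by (simp add: equilibrium_def algebraic_relations_def)
  ultimately have "cost_matrix ctrl $ j $ j * pG $ j = \<xi> $ j"
    using j by (simp add: inverse_cost_matrix_mult_nth)
  \<comment> \<open>The marginal cost at a generating bus is its \<open>\<xi>\<close>-entry;
    \<open>undefined\<close> is just an arbitrary reference bus naming the common value.\<close>
  also have "\<dots> = \<xi> $ undefined" by (rule equilibrium_synchronized[OF assms])
  finally show "cost_matrix ctrl $ j $ j * pG $ j = \<xi> $ undefined" .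
qed fact

end
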